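(* Let $k\ge 2$, let $\mathbb Z_0=\mathbb Z\setminus\{0\}$, and let $\{\lambda_j\}_{j\in\mathbb Z_0}$ be a sequence of positive real parameters. If there is a positive solution $\{z_j\}_{j\in\mathbb Z_0}$ ($z_j>0$ for all $j$) of the system $$z_1=\lambda_1\left(\frac{1+z_1}{1+\sum_{j\in\mathbb Z_0}z_j}\right)^k,\qquad z_i=\lambda_i\left(\frac{1}{1+\sum_{j\in\mathbb Z_0}z_j}\right)^k,\quad i\in\mathbb Z_0\setminus\{1\},$$ then both series $\sum_{j\in\mathbb Z_0}z_j$ and $\sum_{j\in\mathbb Z_0}\lambda_j$ converge.
   Context: A priori the sum $\sum_{j\in\mathbb Z_0}z_j$ of positive terms may equal $+\infty$, in which case the right-hand sides of the system are interpreted as $0$. *)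

theory Defs
  imports "HOL-Analysis.Analysis"
begin

definition Z0 :: "int set" where
  "Z0 = UNIV - {0}"

text \<open>The sum is taken in the extended nonnegative reals, where it always exists and is
  \<open>\<infinity>\<close> if the series diverges. Only families that are positive on \<open>Z0\<close> are considered;
  the value at \<open>0\<close> is irrelevant.\<close>

definition total :: "(int \<Rightarrow> real) \<Rightarrow> ennreal" where
  "total z = (\<Sum>\<^sub>\<infinity>j\<in>Z0. ennreal (z j))"

text \<open>A priori the total may be \<open>\<infinity>\<close>, in which case all right-hand sides are read as \<open>0\<close>.
  In the other case \<^const>\<open>enn2real\<close> is just the embedding's inverse.\<close>

definition positive_solution :: "nat \<Rightarrow> (int \<Rightarrow> real) \<Rightarrow> (int \<Rightarrow> real) \<Rightarrow> bool" where
  "positive_solution k lam z \<longleftrightarrow>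
     (\<forall>j\<in>Z0. z j > 0) \<and>
     z 1 = (if total z = \<infinity> then 0
            else lam 1 * ((1 + z 1) / (1 + enn2real (total z))) ^ k) \<and>
     (\<forall>i\<in>Z0 - {1}.
        z i = (if total z = \<infinity> then 0
               else lam i * (1 / (1 + enn2real (total z))) ^ k))"

end

theory Submission
  imports Defs
begin

text \<open>If the sum of the \<open>z j\<close> were infinite, every right-hand side would be 0,
  contradicting \<open>z 1 > 0\<close>; so that sum is finite. Every equation with index other than
  1 then says that \<open>lam i\<close> is \<open>z i\<close> times one fixed constant, so
  \<open>lam\<close> inherits summability from \<open>z\<close>; the single index 1 cannot affect
  convergence.\<close>

text \<open>Bridges the extended sum used in \<open>total\<close> and real summability: the extended
  sum bounds all finite partial sums, which suffices for nonnegative terms.\<close>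

lemma summable_on_if_infsum_ennreal_finite:
  fixes f :: "'a \<Rightarrow> real"
  assumes nonneg: "\<And>x. x \<in> A \<Longrightarrow> f x \<ge> 0"
    and finite_sum: "(\<Sum>\<^sub>\<infinity>x\<in>A. ennreal (f x)) \<noteq> \<infinity>"
  shows "f summable_on A"
proof (rule nonneg_bdd_above_summable_on)
  show "bdd_above (sum f ` {F. F \<subseteq> A \<and> finite F})"
  proof (rule bdd_aboveI2)
    fix F assume "F \<in> {F. F \<subseteq> A \<and> finite F}"
    then have F: "F \<subseteq> A" "finite F" by auto
    have "ennreal (sum f F) = (\<Sum>x\<in>F. ennreal (f x))"
      using F nonneg by (intro sum_ennreal[symmetric]) auto
    also have "\<dots> \<le> (\<Sum>\<^sub>\<infinity>x\<in>A. ennreal (f x))"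
      using F by (subst nonneg_infsum_complete) (auto intro: SUP_upper)
    \<comment> \<open>Finiteness is essential here: \<open>enn2real\<close> sends infinity to 0, so
      it is monotone only below infinity.\<close>
    finally show "sum f F \<le> enn2real (\<Sum>\<^sub>\<infinity>x\<in>A. ennreal (f x))"
      using finite_sum F nonneg
      by (metis enn2real_ennreal enn2real_mono infinity_ennreal_def subset_iff sum_nonneg
          top.not_eq_extremum)
  qed
qed (use nonneg in auto)

theorem lemma1:
  fixes k :: nat and lam z :: "int \<Rightarrow> real"
  assumes "k \<ge> 2"
    and "\<forall>j\<in>Z0. lam j > 0"
    and "positive_solution k lam z"
  shows "z summable_on Z0 \<and> lam summable_on Z0"
proof
  have pos: "z j > 0" if "j \<in> Z0" for j
    using assms(3) that by (auto simp: positive_solution_def)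
  have one: "1 \<in> Z0" by (simp add: Z0_def)
  have fin: "total z \<noteq> \<infinity>"
    using assms(3) pos[OF one] by (auto simp: positive_solution_def)
  show z: "z summable_on Z0"
    using pos fin
    by (intro summable_on_if_infsum_ennreal_finite) (auto simp: total_def less_imp_le)
  \<comment> \<open>The common denominator of the right-hand sides, a genuine positive real since
    the total is finite.\<close>
  define c where "c = (1 + enn2real (total z)) ^ k"
  have "1 + enn2real (total z) > 0"
    using enn2real_nonneg[of "total z"] by linarith
  then have "c > 0" by (simp add: c_def)
  have lam: "lam i = z i * c" if "i \<in> Z0 - {1}" for i
  proof -
    have "z i = lam i * (1 / (1 + enn2real (total z))) ^ k"
      using assms(3) fin that by (simp add: positive_solution_def)
    then have "z i = lam i / c" by (simp add: c_def power_divide)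
    then show ?thesis using \<open>c > 0\<close> by simp
  qed
  have "z summable_on Z0 - {1}"
    using z by (rule summable_on_subset_banach) auto
  then have "(\<lambda>i. z i * c) summable_on Z0 - {1}"
    by (rule summable_on_cmult_left)
  then have "lam summable_on Z0 - {1}"
    by (subst summable_on_cong[OF lam])
  \<comment> \<open>Index 1 obeys a different equation, so it was left out of the rescaling and is
    added back as a single term.\<close>
  then have "lam summable_on insert 1 (Z0 - {1})"
    by (simp only: summable_on_insert_iff)
  then show "lam summable_on Z0"
    using one by (simp add: insert_absorb)
qed

end
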